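(* Let $k$ and $n$ be non-negative integers. For each $i$ with $1\leq i\leq k+1$, let $p_i$ be a prime number with $p_i\geq 5$ and $p_i\equiv 5,7,11 \pmod{12}$. Then, for any integer $j\not\equiv 0 \pmod{p_{k+1}}$, \[ \sigma mex\left(p_1^2\cdots p_{k+1}^2\, n + p_1^2\cdots p_k^2\, p_{k+1}\, j + \frac{p_1^2\cdots p_k^2\, p_{k+1}^2-1}{12}\right)\equiv 0 \pmod 4 . \]
   Context: For a partition $\pi$ of a positive integer $n$, $mex(\pi)$ is the smallest positive integer that is not a part of $\pi$. For a positive integer $n$, $\sigma mex(n)=\sum_{\pi} mex(\pi)$, summed over all partitions $\pi$ of $n$, and $\sigma mex(0)=1$. Equivalently, $\sum_{n\geq 0}\sigma mex(n)q^n=(-q;q)_\infty^2$, where $(a;q)_\infty=\prod_{m\geq 1}(1-aq^{m-1})$. *)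

theory Defs
  imports "HOL-Library.Multiset" "HOL-Number_Theory.Cong"
begin

definition partitions :: "nat \<Rightarrow> nat multiset set" where
  "partitions n = {\<pi>. (\<forall>x\<in>#\<pi>. 0 < x) \<and> sum_mset \<pi> = n}"

definition mex :: "nat multiset \<Rightarrow> nat" where
  "mex \<pi> = (LEAST m. 0 < m \<and> m \<notin># \<pi>)"

text \<open>At \<open>n = 0\<close> the only partition is the empty one, so the value there is \<open>1\<close>
  (\<open>sigma_mex_0\<close> below), which is the usual convention.\<close>

definition sigma_mex :: "nat \<Rightarrow> nat" where
  "sigma_mex n = (\<Sum>\<pi>\<in>partitions n. mex \<pi>)"

lemma size_partition_le:
  "(\<forall>x\<in>#\<pi>. 0 < x) \<Longrightarrow> size \<pi> \<le> sum_mset (\<pi> :: nat multiset)"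
  by (induction \<pi>) auto

lemma finite_partitions: "finite (partitions n)"
proof (rule finite_subset)
  show "partitions n \<subseteq> mset ` {xs. set xs \<subseteq> {..n} \<and> length xs \<le> n}"
  proof
    fix \<pi> assume \<pi>: "\<pi> \<in> partitions n"
    obtain xs where xs: "mset xs = \<pi>" using ex_mset by blast
    have "length xs \<le> n"
      using \<pi> size_partition_le[of \<pi>] size_mset[of xs] unfolding xs partitions_def by simp
    moreover have "set xs \<subseteq> {..n}"
    proof
      fix x assume "x \<in> set xs"
      then have "x \<le> sum_list xs" by (intro member_le_sum_list) simp_all
      then show "x \<in> {..n}"
        using \<pi> sum_mset_sum_list[of xs] unfolding xs partitions_def by simp
    qed
    ultimately show "\<pi> \<in> mset ` {xs. set xs \<subseteq> {..n} \<and> length xs \<le> n}"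
      using xs by auto
  qed
  show "finite (mset ` {xs. set xs \<subseteq> {..n} \<and> length xs \<le> n})"
    by (intro finite_imageI finite_lists_length_le) simp
qed

lemma sigma_mex_0: "sigma_mex 0 = 1"
proof -
  have "partitions 0 = {{#}}"
  proof (intro set_eqI iffI)
    fix \<pi> assume "\<pi> \<in> partitions 0"
    then have "size \<pi> \<le> 0"
      using size_partition_le[of \<pi>] unfolding partitions_def mem_Collect_eq by metis
    then show "\<pi> \<in> {{#}}" by simp
  qed (simp add: partitions_def)
  moreover have "mex {#} = 1"
    unfolding mex_def by (rule Least_equality) auto
  ultimately show ?thesis by (simp add: sigma_mex_def)
qed

end

theory Submission
  imports Defs "HOL-Computational_Algebra.Formal_Power_Series" "HOL-Number_Theory.Residues"
begin

text \<open>
  Let \<open>f\<^sub>m\<close> be the product of all \<open>1 - q\<^bsup>m i\<^esup>\<close>, \<open>i \<ge> 1\<close>. Counting the partitions with mex larger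
  than \<open>k\<close> shows that the generating function \<open>G\<close> of \<open>sigma_mex\<close> satisfies \<open>G f\<^sub>1 = \<psi>(q)\<close>, the sum of
  \<open>q\<^bsup>k(k+1)/2\<^esup>\<close>. Gauss' identity \<open>\<psi>(q) f\<^sub>1 = f\<^sub>2\<^sup>2\<close> and \<open>f\<^sub>1\<^sup>4 \<equiv> f\<^sub>2\<^sup>2 (mod 4)\<close> give
  \<open>G \<equiv> f\<^sub>1\<^sup>2 (mod 4)\<close>. By the pentagonal number theorem the coefficient of \<open>q\<^sup>N\<close> in \<open>f\<^sub>1\<^sup>2\<close> vanishes
  unless \<open>2 (12 N + 1)\<close> has the form \<open>u\<^sup>2 + v\<^sup>2\<close>; by \<open>f\<^sub>1\<^sup>2 = \<phi>(-q) f\<^sub>2\<close> it vanishes unless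
  \<open>12 N + 1\<close> has the form \<open>u\<^sup>2 + 3 v\<^sup>2\<close>. A prime \<open>p \<equiv> 3 (mod 4)\<close> occurs to an even power in
  every value of the first form, an odd prime \<open>p \<equiv> 2 (mod 3)\<close> in every value of the second, whereas
  in the theorem \<open>p\<^bsub>k+1\<^esub>\<close> occurs to an odd power in \<open>12 N + 1\<close>.

  All theta function identities are instances of the Jacobi triple product, obtained from the
  finite \<open>q\<close>-binomial theorem; infinite products are replaced by finite ones modulo a power of \<open>q\<close>.
\<close>

unbundle fps_syntax

subsection \<open>The finite Jacobi triple product\<close>

text \<open>Gaussian binomial coefficients, given by a \<open>q\<close>-Pascal rule so that they
  exist in any commutative ring without division. The truncated \<open>n - k\<close> is harmless,
  since for \<open>n < k\<close> its cofactor is 0.\<close>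

fun qbinomial :: "'a::comm_ring_1 \<Rightarrow> nat \<Rightarrow> nat \<Rightarrow> 'a" where
  "qbinomial q n 0 = 1"
| "qbinomial q 0 (Suc k) = 0"
| "qbinomial q (Suc n) (Suc k) = qbinomial q n (Suc k) + q ^ (n - k) * qbinomial q n k"

text \<open>The finite product \<open>(q; q)_n\<close>; at \<open>q = fps_X ^ m\<close> it is a
  truncation of the product written \<open>f\<close> with index \<open>m\<close> in the
  overview.\<close>

definition qpoch :: "'a::comm_ring_1 \<Rightarrow> nat \<Rightarrow> 'a" where
  "qpoch q n = (\<Prod>i=1..n. 1 - q ^ i)"

lemma qpoch_0 [simp]: "qpoch q 0 = 1"
  by (simp add: qpoch_def)

lemma qpoch_Suc: "qpoch q (Suc n) = qpoch q n * (1 - q ^ Suc n)"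
  by (simp add: qpoch_def)

lemma qbinomial_eq_0: "n < k \<Longrightarrow> qbinomial q n k = 0"
  by (induction q n k rule: qbinomial.induct) auto

lemma qbinomial_self [simp]: "qbinomial q n n = 1"
  by (induction n) (auto simp: qbinomial_eq_0)

text \<open>The quotient formula for Gaussian binomials, cleared of denominators.\<close>

lemma qbinomial_qpoch:
  "k \<le> n \<Longrightarrow> qbinomial q n k * qpoch q k * qpoch q (n - k) = qpoch q n"
proof (induction q n k rule: qbinomial.induct)
  case (3 q n k)
  show ?case
  proof (cases "k = n")
    case False
    then have "k < n" using 3 by simp
    then obtain d where d: "n = Suc (k + d)" using less_iff_Suc_add by auto
    have a: "qbinomial q n (Suc k) * qpoch q (Suc k) * qpoch q d = qpoch q n"
      using 3(1) d by simp
    have b: "qbinomial q n k * qpoch q k * qpoch q (Suc d) = qpoch q n"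
      using 3(2) d by (simp add: Suc_diff_le)
    \<comment> \<open>With \<open>n = k + d + 1\<close>, the weights \<open>1 - q ^ Suc d\<close>
      and \<open>q ^ Suc d * (1 - q ^ Suc k)\<close> of the two Pascal terms add up to
      \<open>1 - q ^ Suc n\<close>.\<close>
    have "qbinomial q (Suc n) (Suc k) * qpoch q (Suc k) * qpoch q (Suc d)
        = (qbinomial q n (Suc k) * qpoch q (Suc k) * qpoch q d) * (1 - q ^ Suc d)
        + q ^ Suc d * (1 - q ^ Suc k) * (qbinomial q n k * qpoch q k * qpoch q (Suc d))"
      using d by (simp add: qpoch_Suc Suc_diff_le algebra_simps)
    also have "\<dots> = qpoch q n * (1 - q ^ Suc d * q ^ Suc k)"
      unfolding a b by (simp add: algebra_simps)
    also have "q ^ Suc d * q ^ Suc k = q ^ Suc n"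
      by (simp add: d algebra_simps flip: power_add)
    finally show ?thesis unfolding qpoch_Suc[of q n] using d by simp
  qed (simp add: qbinomial_eq_0)
qed auto

text \<open>The homogeneous form in \<open>y\<close> and \<open>z\<close> allows a power of
  \<open>q\<close> to be put for \<open>y\<close> later. In the induction the two summands of the
  last factor \<open>y + z * q ^ m\<close> produce the two terms of the Pascal rule.\<close>

theorem qbinomial_theorem:
  fixes q y z :: "'a::comm_ring_1"
  shows "(\<Prod>i<m. y + z * q ^ i)
    = (\<Sum>k\<le>m. q ^ (k choose 2) * qbinomial q m k * z ^ k * y ^ (m - k))"
proof (induction m)
  case (Suc m)
  let ?t = "\<lambda>k. q ^ (k choose 2) * qbinomial q m k * z ^ k * y ^ (Suc m - k)"
  let ?u = "\<lambda>k. q ^ (Suc k choose 2) * q ^ (m - k) * qbinomial q m k * z ^ Suc k * y ^ (m - k)"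
  have 1: "y * (\<Sum>k\<le>m. q ^ (k choose 2) * qbinomial q m k * z ^ k * y ^ (m - k)) = (\<Sum>k\<le>Suc m. ?t k)"
    unfolding sum_distrib_left by (simp add: qbinomial_eq_0 Suc_diff_le algebra_simps)
  have 2: "z * q ^ m * (\<Sum>k\<le>m. q ^ (k choose 2) * qbinomial q m k * z ^ k * y ^ (m - k)) = (\<Sum>k\<le>m. ?u k)"
    unfolding sum_distrib_left
  proof (rule sum.cong)
    fix k assume "k \<in> {..m}"
    then have "q ^ (Suc k choose 2) * q ^ (m - k) = q ^ m * q ^ (k choose 2)"
      by (simp add: numeral_2_eq_2 add.commute flip: power_add)
    then show "z * q ^ m * (q ^ (k choose 2) * qbinomial q m k * z ^ k * y ^ (m - k)) = ?u k"
      by (simp add: algebra_simps)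
  qed simp
  have "(\<Prod>i<Suc m. y + z * q ^ i) = (\<Sum>k\<le>Suc m. ?t k) + (\<Sum>k\<le>m. ?u k)"
    unfolding prod.lessThan_Suc Suc 1[symmetric] 2[symmetric] by (simp add: algebra_simps)
  also have "\<dots> = ?t 0 + (\<Sum>k\<le>m. ?t (Suc k) + ?u k)"
    unfolding sum.atMost_Suc_shift sum.distrib by (simp add: add.assoc)
  also have "\<dots> = (\<Sum>k\<le>Suc m. q ^ (k choose 2) * qbinomial q (Suc m) k * z ^ k * y ^ (Suc m - k))"
    unfolding sum.atMost_Suc_shift by (simp add: algebra_simps)
  finally show ?case .
qed (simp add: numeral_2_eq_2)

text \<open>The triangular exponent of the Jacobi triple product for an index of either sign.
  \<open>nat\<close> loses nothing, since \<open>j * (j - 1)\<close> is nonnegative on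
  integers.\<close>

definition pronic_half :: "int \<Rightarrow> nat" where
  "pronic_half j = nat (j * (j - 1) div 2)"

lemma pronic_half: "2 * int (pronic_half j) = j * (j - 1)"
proof -
  have "j * (j - 1) \<ge> 0" by (cases "j \<ge> 1") (auto intro: mult_nonpos_nonpos)
  moreover have "even (j * (j - 1))" by simp
  ultimately show ?thesis by (simp add: pronic_half_def)
qed

lemma two_choose_two: "2 * int (k choose 2) = int k * (int k - 1)"
proof -
  have "2 * (k choose 2) = k * (k - 1)"
    unfolding choose_two by (intro dvd_mult_div_cancel) (cases k, auto)
  then have "2 * int (k choose 2) = int (k * (k - 1))" by presburger
  then show ?thesis by (cases k) (auto simp: algebra_simps)
qed

lemma sum_lessThan_id: "(\<Sum>i<n. i) = (n choose 2)"
  by (induction n) (auto simp: numeral_2_eq_2)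

lemma finite_jacobi_triple_product:
  fixes q z :: "'a::idom"
  assumes "q \<noteq> 0"
  shows "(\<Prod>i=1..n. z + q ^ i) * (\<Prod>i<n. 1 + z * q ^ i)
    = (\<Sum>k\<le>2*n. q ^ pronic_half (int k - int n) * qbinomial q (2*n) k * z ^ k)"
proof -
  define c where "c = (n choose 2) + n * n"
  \<comment> \<open>The \<open>q\<close>-binomial theorem with \<open>2 n\<close> factors and \<open>y = q\<^sup>n\<close>; both sides are divisible by \<open>q\<^sup>c\<close>.\<close>
  have "{..<2*n} = {..<n} \<union> {n..<n+n}" by auto
  then have "(\<Prod>i<2*n. q ^ n + z * q ^ i) = (\<Prod>i<n. q ^ n + z * q ^ i) * (\<Prod>i=n..<n+n. q ^ n + z * q ^ i)"
    by (simp add: prod.union_disjoint ivl_disj_int)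
  also have "(\<Prod>i=n..<n+n. q ^ n + z * q ^ i) = (\<Prod>i<n. q ^ n * (1 + z * q ^ i))"
    using prod.shift_bounds_nat_ivl[of "\<lambda>i. q ^ n + z * q ^ i" 0 n n]
    by (simp add: atLeast0LessThan power_add algebra_simps)
  also have "\<dots> = q ^ (n * n) * (\<Prod>i<n. 1 + z * q ^ i)"
    by (simp add: prod.distrib power_mult)
  also have "(\<Prod>i<n. q ^ n + z * q ^ i) = (\<Prod>i<n. q ^ i * (z + q ^ (n - i)))"
    by (rule prod.cong) (auto simp: algebra_simps simp flip: power_add)
  also have "\<dots> = q ^ (n choose 2) * (\<Prod>i<n. z + q ^ (n - i))"
    by (simp add: prod.distrib power_sum sum_lessThan_id[symmetric])
  also have "(\<Prod>i<n. z + q ^ (n - i)) = (\<Prod>i=1..n. z + q ^ i)"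
    by (rule prod.reindex_bij_witness[of _ "\<lambda>i. n - i" "\<lambda>i. n - i"]) auto
  finally have 1: "(\<Prod>i<2*n. q ^ n + z * q ^ i)
      = q ^ c * ((\<Prod>i=1..n. z + q ^ i) * (\<Prod>i<n. 1 + z * q ^ i))"
    by (simp add: c_def power_add algebra_simps)
  have "(\<Prod>i<2*n. q ^ n + z * q ^ i)
    = (\<Sum>k\<le>2*n. q ^ (k choose 2) * qbinomial q (2*n) k * z ^ k * (q ^ n) ^ (2*n - k))"
    by (rule qbinomial_theorem)
  also have "\<dots> = q ^ c * (\<Sum>k\<le>2*n. q ^ pronic_half (int k - int n) * qbinomial q (2*n) k * z ^ k)"
    unfolding sum_distrib_left
  proof (rule sum.cong)
    fix k assume k: "k \<in> {..2*n}"
    \<comment> \<open>Exponents are compared after doubling and passing to integers, which removes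
      both the halves and the truncated subtraction.\<close>
    then have "2 * int ((k choose 2) + n * (2*n - k)) = 2 * int (c + pronic_half (int k - int n))"
      unfolding c_def of_nat_add distrib_left two_choose_two pronic_half
      by (simp add: of_nat_diff algebra_simps)
    then have "(k choose 2) + n * (2*n - k) = c + pronic_half (int k - int n)"
      by (simp only: mult_cancel_left of_nat_eq_iff) simp
    then have "q ^ (k choose 2) * (q ^ n) ^ (2*n - k) = q ^ c * q ^ pronic_half (int k - int n)"
      by (simp flip: power_add power_mult)
    then show "q ^ (k choose 2) * qbinomial q (2*n) k * z ^ k * (q ^ n) ^ (2*n - k)
      = q ^ c * (q ^ pronic_half (int k - int n) * qbinomial q (2*n) k * z ^ k)"
      by (simp add: algebra_simps)
  qed simp
  finally show ?thesis using assms unfolding 1 by simp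
qed

text \<open>The library's \<open>cong\<close> is not available for integer power series, which do not form a
  Euclidean ring.\<close>

definition dcong :: "'a::comm_ring_1 \<Rightarrow> 'a \<Rightarrow> 'a \<Rightarrow> bool" where
  "dcong m a b \<longleftrightarrow> m dvd a - b"

lemma dcong_refl [simp]: "dcong m a a" by (simp add: dcong_def)

lemma dcong_sym: "dcong m a b \<Longrightarrow> dcong m b a"
  unfolding dcong_def using dvd_minus_iff[of m "a - b"] by simp

lemma dcong_trans [trans]: "dcong m a b \<Longrightarrow> dcong m b c \<Longrightarrow> dcong m a c"
  unfolding dcong_def using dvd_add[of m "a - b" "b - c"] by simp

lemma dcong_mult: "dcong m a b \<Longrightarrow> dcong m c d \<Longrightarrow> dcong m (a * c) (b * d)"
proof -
  assume "dcong m a b" "dcong m c d"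
  then have "m dvd (a - b) * c + b * (c - d)" unfolding dcong_def by (intro dvd_add) auto
  then show ?thesis unfolding dcong_def by (simp add: algebra_simps)
qed

lemma dcong_sum: "(\<And>i. i \<in> A \<Longrightarrow> dcong m (f i) (g i)) \<Longrightarrow> dcong m (sum f A) (sum g A)"
  unfolding dcong_def sum_subtractf[symmetric] by (rule dvd_sum)

lemma dcong_dvd: "dcong m a b \<Longrightarrow> l dvd m \<Longrightarrow> dcong l a b"
  unfolding dcong_def by (rule dvd_trans)

lemma dcong_mult_cancel:
  assumes "u dvd 1" "dcong m (u * a) (u * b)"
  shows "dcong m a b"
proof -
  obtain w where w: "1 = u * w" using assms(1) by (elim dvdE)
  from dcong_mult[OF dcong_refl[of _ w] assms(2)] have "dcong m (u * w * a) (u * w * b)"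
    by (simp only: mult_ac)
  then show ?thesis unfolding w[symmetric] by simp
qed

text \<open>Each additional factor \<open>1 - q ^ i\<close> has \<open>i > k\<close> and is 1 modulo
  \<open>q ^ Suc k\<close>.\<close>

lemma dcong_qpoch:
  assumes "k \<le> m" shows "dcong (q ^ Suc k) (qpoch q m) (qpoch q k)"
  using assms
proof (induction m rule: dec_induct)
  case (step m)
  have "q ^ Suc k dvd q ^ Suc m" using step by (intro le_imp_power_dvd) simp
  then have "dcong (q ^ Suc k) (1 - q ^ Suc m) 1" unfolding dcong_def by (simp add: dvd_minus_iff)
  from dcong_mult[OF step.IH this] show ?case by (simp add: qpoch_Suc)
qed simp

text \<open>In the quotient formula both denominators agree with \<open>qpoch q m\<close> modulo
  \<open>q ^ r\<close>, and one copy of this unit cancels. It is a truncated form of the limit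
  \<open>1 / (q; q)_\<infinity>\<close> of central Gaussian binomials.\<close>

lemma dcong_qbinomial_qpoch:
  assumes "k \<le> m" "qpoch q m dvd 1" "r \<le> Suc k" "r \<le> Suc (m - k)"
  shows "dcong (q ^ r) (qbinomial q m k * qpoch q m) 1"
proof -
  have "dcong (q ^ r) (qpoch q k) (qpoch q m)" "dcong (q ^ r) (qpoch q (m - k)) (qpoch q m)"
    using assms dcong_qpoch[of k m q] dcong_qpoch[of "m - k" m q]
    by (meson dcong_dvd dcong_sym diff_le_self le_imp_power_dvd)+
  from dcong_mult[OF dcong_mult[OF dcong_refl[of _ "qbinomial q m k"] this(1)] this(2)]
  have "dcong (q ^ r) (qpoch q m) (qpoch q m * (qbinomial q m k * qpoch q m))"
    using assms(1) by (simp only: qbinomial_qpoch) (simp only: mult_ac)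
  then have "dcong (q ^ r) (qpoch q m * (qbinomial q m k * qpoch q m)) (qpoch q m * 1)"
    unfolding mult_1_right by (rule dcong_sym)
  then show ?thesis by (rule dcong_mult_cancel[OF assms(2)])
qed

text \<open>Term by term: the Gaussian binomial times \<open>qpoch q (2*n)\<close> is 1 modulo
  \<open>q ^ r\<close>. Here \<open>r\<close> is small only near the ends of the range, where the
  triangular exponent \<open>T\<close> makes up for it: \<open>n \<le> T + r\<close>.\<close>

lemma jacobi_triple_product_dcong:
  fixes q z :: "'a::idom"
  assumes "q \<noteq> 0" "qpoch q (2*n) dvd 1"
  shows "dcong (q ^ n) (qpoch q (2*n) * ((\<Prod>i=1..n. z + q ^ i) * (\<Prod>i<n. 1 + z * q ^ i)))
     (\<Sum>k\<le>2*n. q ^ pronic_half (int k - int n) * z ^ k)"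
  unfolding finite_jacobi_triple_product[OF assms(1)] sum_distrib_left
proof (rule dcong_sum)
  fix k assume k: "k \<in> {..2*n}"
  define T where "T = pronic_half (int k - int n)"
  define r where "r = Suc (min k (2*n - k))"
  have "int n \<le> int T + int r"
  proof -
    define j where "j = int k - int n"
    have "int r = 1 + int n - \<bar>j\<bar>" using k unfolding r_def j_def by auto
    moreover have "2 * int T \<ge> 2 * (\<bar>j\<bar> - 1)"
    proof -
      \<comment> \<open>No integer lies strictly between the roots. Expanding bounds the triangular
        number below by \<open>\<bar>j\<bar> - 1\<close>, with one product for each sign of
        \<open>j\<close>.\<close>
      have "(j - 1) * (j - 2) \<ge> 0" by (cases "j \<ge> 2") (auto intro: mult_nonpos_nonpos)
      moreover have "j \<ge> 0 \<or> (j + 1) * (j + 2) \<ge> 0" 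
        by (cases "j \<ge> -1"; cases "j \<ge> 0") (auto intro: mult_nonpos_nonpos)
      ultimately show ?thesis unfolding T_def j_def[symmetric] pronic_half
        by (auto simp: algebra_simps abs_if)
    qed
    ultimately show ?thesis by arith
  qed
  then have d: "q ^ n dvd q ^ T * q ^ r" by (simp add: le_imp_power_dvd flip: power_add)
  have "dcong (q ^ r) (qbinomial q (2*n) k * qpoch q (2*n)) 1"
    using k assms(2) unfolding r_def by (intro dcong_qbinomial_qpoch) auto
  then have "q ^ T * q ^ r dvd q ^ T * (qbinomial q (2*n) k * qpoch q (2*n) - 1)"
    unfolding dcong_def by (rule mult_dvd_mono[OF dvd_refl])
  then have "q ^ n dvd q ^ T * (qbinomial q (2*n) k * qpoch q (2*n) - 1) * z ^ k"
    using d by (meson dvd_mult2 dvd_trans)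
  then show "dcong (q ^ n) (qpoch q (2*n) * (q ^ T * qbinomial q (2*n) k * z ^ k)) (q ^ T * z ^ k)"
    unfolding dcong_def by (simp add: algebra_simps)
qed

subsection \<open>Theta functions\<close>

lemma fps_dvd_1_if_nth_0:
  fixes f :: "int fps"
  assumes "f $ 0 = 1" shows "f dvd 1"
  using fps_right_inverse[of f 1] assms by (metis dvdI mult_1)

lemma fps_X_power_dvd_iff_nth:
  fixes f :: "'a::comm_ring_1 fps"
  shows "fps_X ^ n dvd f \<longleftrightarrow> (\<forall>i<n. f $ i = 0)"
proof
  assume "\<forall>i<n. f $ i = 0"
  then have "f = fps_X ^ n * fps_shift n f" by (auto simp: fps_eq_iff fps_X_power_mult_nth)
  then show "fps_X ^ n dvd f" by (metis dvd_triv_left)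
qed (auto simp: fps_X_power_mult_nth)

lemma dcong_fps_X_power:
  fixes f g :: "'a::comm_ring_1 fps"
  shows "dcong (fps_X ^ n) f g \<longleftrightarrow> (\<forall>i<n. f $ i = g $ i)"
  by (simp add: dcong_def fps_X_power_dvd_iff_nth)

lemma qpoch_nth_0: "(q :: int fps) $ 0 = 0 \<Longrightarrow> qpoch q n $ 0 = 1"
  by (induction n) (auto simp: qpoch_Suc)

lemma qpoch_dvd_1: "(q :: int fps) $ 0 = 0 \<Longrightarrow> qpoch q n dvd 1"
  by (intro fps_dvd_1_if_nth_0 qpoch_nth_0)

text \<open>The exponents up to \<open>3 * n\<close> are sorted by their residue modulo 3.\<close>

lemma qpoch_cube:
  "qpoch (q ^ 3) n * ((\<Prod>i<n. 1 - q ^ (3*i + 2)) * (\<Prod>i<n. 1 - q ^ (3*i + 1))) = qpoch q (3 * n)"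
proof (induction n)
  case (Suc n)
  have *: "3 * Suc n = Suc (Suc (Suc (3 * n)))" by simp
  show ?case unfolding * qpoch_Suc Suc[symmetric] power_mult[symmetric] prod.lessThan_Suc
    by (simp add: mult_ac)
qed simp

lemma qpoch_square:
  "qpoch (q ^ 2) n * (\<Prod>i<n. 1 - q ^ (2*i + 1)) = qpoch q (2 * n)"
proof (induction n)
  case (Suc n)
  have *: "2 * Suc n = Suc (Suc (2 * n))" by simp
  show ?case unfolding * qpoch_Suc Suc[symmetric] power_mult[symmetric] prod.lessThan_Suc
    by (simp add: mult_ac)
qed simp

lemma qpoch_mult_prod_plus: "qpoch q n * (\<Prod>i=1..n. 1 + q ^ i) = qpoch (q ^ 2) n"
proof (induction n)
  case (Suc n)
  have "(1 - q ^ Suc n) * (1 + q ^ Suc n) = 1 - (q ^ 2) ^ Suc n"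
    by (simp add: algebra_simps power2_eq_square power_mult_distrib)
  moreover have "qpoch q (Suc n) * (\<Prod>i=1..Suc n. 1 + q ^ i)
    = (qpoch q n * (\<Prod>i=1..n. 1 + q ^ i)) * ((1 - q ^ Suc n) * (1 + q ^ Suc n))"
    by (simp add: qpoch_Suc mult_ac del: power_Suc)
  ultimately show ?case by (simp only: Suc qpoch_Suc)
qed simp

text \<open>The value is \<open>b * j * (j - 1) / 2 + j\<close>: generalized pentagonal numbers for
  \<open>b = 3\<close>, squares for \<open>b = 2\<close>.\<close>

definition theta_exp :: "nat \<Rightarrow> int \<Rightarrow> nat" where
  "theta_exp b j = nat (int b * int (pronic_half j) + j)"

text \<open>The truncation by \<open>nat\<close> is harmless for positive \<open>b\<close>: at
  \<open>b = 1\<close> the value is \<open>j * (j + 1) / 2\<close>, and larger \<open>b\<close> only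
  add nonnegative multiples of \<open>pronic_half j\<close>.\<close>

lemma int_theta_exp:
  assumes "b > 0"
  shows "2 * int (theta_exp b j) = j * (int b * (j - 1) + 2)"
proof -
  have "2 * (int (pronic_half j) + j) = j * (j + 1)"
    using pronic_half[of j] by (simp add: algebra_simps)
  moreover have "j * (j + 1) \<ge> 0" by (cases "j \<ge> 0") (auto intro: mult_nonpos_nonpos)
  ultimately have "2 * (int (pronic_half j) + j) \<ge> 0" by (simp only:)
  then have "int (pronic_half j) + j \<ge> 0" unfolding zero_le_mult_iff by simp
  moreover have "1 * int (pronic_half j) \<le> int b * int (pronic_half j)"
    using assms by (intro mult_right_mono) auto
  ultimately have "int b * int (pronic_half j) + j \<ge> 0" by linarith
  then have "2 * int (theta_exp b j) = int b * (2 * int (pronic_half j)) + 2 * j"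
    by (simp add: theta_exp_def)
  then show ?thesis unfolding pronic_half by (simp add: algebra_simps)
qed

lemma minus_power_rearrange:
  fixes y :: "'a::comm_ring_1"
  assumes "a + k = n + b"
  shows "y ^ a * (- y) ^ k = (- y) ^ n * ((-1) ^ (k + n) * y ^ b)"
proof -
  have "y ^ a * (- y) ^ k = (-1) ^ k * y ^ (a + k)"
    by (simp add: power_minus[of y] power_add mult_ac)
  also have "(-1) ^ k = (-1 :: 'a) ^ n * (-1) ^ (k + n)"
    by (auto simp: minus_one_power_iff)
  finally show ?thesis unfolding assms by (simp add: power_minus[of y n] power_add mult_ac)
qed

text \<open>The case \<open>b = 1\<close> is the pentagonal number theorem, and \<open>b = 0\<close> the product for \<open>\<phi>(-q)\<close>.\<close>

lemma theta_dcong: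
  fixes y :: "int fps"
  assumes "y \<noteq> 0" "y $ 0 = 0"
  shows "dcong (y ^ n)
    (qpoch (y ^ (b + 2)) n * ((\<Prod>i<n. 1 - y ^ ((b+2)*i + b + 1)) * (\<Prod>i<n. 1 - y ^ ((b+2)*i + 1))))
    (\<Sum>k\<le>2*n. (-1) ^ (k + n) * y ^ theta_exp (b + 2) (int k - int n))"
proof -
  define q where "q = y ^ (b + 2)"
  let ?P1 = "\<Prod>i<n. 1 - y ^ ((b+2)*i + b + 1)" and ?P2 = "\<Prod>i<n. 1 - y ^ ((b+2)*i + 1)"
  let ?S = "\<Sum>k\<le>2*n. (-1) ^ (k + n) * y ^ theta_exp (b + 2) (int k - int n)"
  have q: "q \<noteq> 0" "q $ 0 = 0" using assms by (auto simp: q_def fps_power_zeroth)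
  \<comment> \<open>The triple product with base \<open>q = y ^ (b + 2)\<close> and
    \<open>z = - y\<close>.\<close>
  have 1: "dcong (q ^ n) (qpoch q (2*n) * ((\<Prod>i=1..n. - y + q ^ i) * (\<Prod>i<n. 1 + (- y) * q ^ i)))
     (\<Sum>k\<le>2*n. q ^ pronic_half (int k - int n) * (- y) ^ k)"
    using q by (intro jacobi_triple_product_dcong qpoch_dvd_1)
  have "(\<Prod>i=1..n. - y + q ^ i) = (\<Prod>i<n. - y + q ^ (Suc i))"
    by (rule prod.reindex_bij_witness[of _ Suc "\<lambda>i. i - 1"]) auto
  also have "\<dots> = (\<Prod>i<n. (- y) * (1 - y ^ ((b+2)*i + b + 1)))"
  proof (rule prod.cong)
    fix i
    have "q ^ Suc i = y * y ^ ((b+2)*i + b + 1)"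
      unfolding q_def power_mult[symmetric] power_Suc[symmetric]
      by (rule arg_cong[where f = "power y"]) simp
    then show "- y + q ^ Suc i = (- y) * (1 - y ^ ((b+2)*i + b + 1))"
      by (simp only: right_diff_distrib) simp
  qed simp
  also have "\<dots> = (- y) ^ n * ?P1"
    by (simp only: prod.distrib) simp
  finally have 2: "(\<Prod>i=1..n. - y + q ^ i) = (- y) ^ n * ?P1" .
  have 3: "(\<Prod>i<n. 1 + (- y) * q ^ i) = ?P2"
  proof (rule prod.cong)
    fix i
    have "y * q ^ i = y ^ ((b+2)*i + 1)"
      unfolding q_def power_mult[symmetric] by simp
    then show "1 + (- y) * q ^ i = 1 - y ^ ((b+2)*i + 1)" by simp
  qed simp
  have 4: "(\<Sum>k\<le>2*n. q ^ pronic_half (int k - int n) * (- y) ^ k) = (- y) ^ n * ?S"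
    unfolding sum_distrib_left
  proof (rule sum.cong)
    fix k assume "k \<in> {..2*n}"
    define j where "j = int k - int n"
    have "2 * int ((b + 2) * pronic_half j + k) = int (b + 2) * (2 * int (pronic_half j)) + 2 * int k"
      by (simp add: algebra_simps)
    also have "\<dots> = 2 * int n + 2 * int (theta_exp (b + 2) j)"
      using int_theta_exp[of "b + 2" j] unfolding pronic_half by (simp add: j_def algebra_simps)
    finally have "2 * int ((b + 2) * pronic_half j + k) = 2 * int (n + theta_exp (b + 2) j)"
      by (simp only: of_nat_add distrib_left)
    then have "(b + 2) * pronic_half j + k = n + theta_exp (b + 2) j"
      by (simp only: mult_cancel_left of_nat_eq_iff) simp
    then show "q ^ pronic_half j * (- y) ^ k = (- y) ^ n * ((-1) ^ (k + n) * y ^ theta_exp (b + 2) j)"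
      unfolding q_def power_mult[symmetric] by (rule minus_power_rearrange)
  qed simp
  have "q ^ n dvd (- y) ^ n * (qpoch q (2*n) * (?P1 * ?P2) - ?S)"
    using 1 unfolding 2 3 4 dcong_def by (simp only: right_diff_distrib mult_ac)
  \<comment> \<open>The common factor \<open>(- y) ^ n\<close> is to be cancelled. As
    \<open>q\<close> is divisible by \<open>y\<^sup>2\<close>, the modulus \<open>q ^ n\<close> can
    pay for it and still leave \<open>y ^ n\<close>.\<close>
  moreover have "(- y) ^ n * y ^ n dvd q ^ n"
  proof -
    have "q = (- y * y) * - (y ^ b)" by (simp add: q_def power2_eq_square)
    then have "- y * y dvd q" by (rule dvdI)
    then show ?thesis unfolding power_mult_distrib[symmetric] by (rule dvd_power_same)
  qed
  ultimately have "(- y) ^ n * y ^ n dvd (- y) ^ n * (qpoch q (2*n) * (?P1 * ?P2) - ?S)"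
    by (rule dvd_trans[rotated])
  then have A: "dcong (y ^ n) (qpoch q (2*n) * (?P1 * ?P2)) ?S"
    unfolding dcong_def using assms(1) by simp
  have "y ^ n dvd q ^ Suc n"
    unfolding q_def power_mult[symmetric] by (rule le_imp_power_dvd) simp
  then have "dcong (y ^ n) (qpoch q n) (qpoch q (2*n))"
    by (intro dcong_sym[OF dcong_dvd[OF dcong_qpoch]]) simp_all
  from dcong_trans[OF dcong_mult[OF this dcong_refl] A] show ?thesis unfolding q_def .
qed

lemma dcong_qpoch_power: "n \<le> m \<Longrightarrow> dcong (q ^ n) (qpoch q n) (qpoch q m)"
  by (rule dcong_sym[OF dcong_dvd[OF dcong_qpoch]]) (simp_all add: le_imp_power_dvd)

section \<open>Pentagonal, square and triangular exponents\<close>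

lemma pentagonal_dcong:
  fixes y :: "int fps"
  assumes "y \<noteq> 0" "y $ 0 = 0"
  shows "dcong (y ^ n) (qpoch y n) (\<Sum>k\<le>2*n. (-1) ^ (k + n) * y ^ theta_exp 3 (int k - int n))"
proof -
  have "(1 :: nat) + 2 = 3" "(3 * i + 1 + 1 :: nat) = 3 * i + 2" for i :: nat by simp_all
  from theta_dcong[OF assms, of n 1, unfolded this qpoch_cube]
  have "dcong (y ^ n) (qpoch y (3 * n)) (\<Sum>k\<le>2*n. (-1) ^ (k + n) * y ^ theta_exp 3 (int k - int n))" .
  with dcong_qpoch_power show ?thesis by (rule dcong_trans) simp
qed

lemma fps_sum_nth_neq_0:
  assumes "(\<Sum>k\<in>A. (-1) ^ s k * fps_X ^ e k :: int fps) $ i \<noteq> 0"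
  shows "\<exists>k\<in>A. e k = i"
proof (rule ccontr)
  assume "\<not> ?thesis"
  then have "((-1) ^ s k * fps_X ^ e k :: int fps) $ i = 0" if "k \<in> A" for k
    using that by (cases "even (s k)") auto
  then show False using assms by (simp add: fps_sum_nth)
qed

text \<open>Only the support of the pentagonal series matters, so signs and possible cancellation
  can be ignored. Below degree \<open>n\<close> the truncated product has the same coefficients as
  this series.\<close>

lemma qpoch_nth_neq_0:
  assumes "(qpoch (fps_X ^ c) n :: int fps) $ i \<noteq> 0" "i < n" "c > 0"
  shows "\<exists>j::int. 2 * int i = int c * (j * (3 * j - 1))"
proof -
  let ?e = "\<lambda>k. c * theta_exp 3 (int k - int n)"
  have "fps_X ^ n dvd ((fps_X ^ c) ^ n :: int fps)"
    unfolding power_mult[symmetric] using assms(3) by (intro le_imp_power_dvd) simp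
  moreover have "dcong ((fps_X ^ c) ^ n) (qpoch (fps_X ^ c) n :: int fps)
     (\<Sum>k\<le>2*n. (-1) ^ (k + n) * fps_X ^ ?e k)"
    using pentagonal_dcong[of "fps_X ^ c" n] assms(3) by (simp add: power_mult)
  ultimately have "dcong (fps_X ^ n) (qpoch (fps_X ^ c) n :: int fps)
     (\<Sum>k\<le>2*n. (-1) ^ (k + n) * fps_X ^ ?e k)"
    by (rule dcong_dvd[rotated])
  then have "(\<Sum>k\<le>2*n. (-1) ^ (k + n) * fps_X ^ ?e k :: int fps) $ i \<noteq> 0"
    using assms(1,2) unfolding dcong_fps_X_power by simp
  from fps_sum_nth_neq_0[OF this] obtain k where "?e k = i" by blast
  then have "2 * int i = int c * (2 * int (theta_exp 3 (int k - int n)))" by auto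
  also have "\<dots> = int c * ((int k - int n) * (3 * (int k - int n) - 1))"
    by (subst int_theta_exp) (simp_all add: algebra_simps)
  finally show ?thesis by blast
qed

text \<open>\<open>\<phi>\<close> is a truncation of the alternating theta series over squares. Its
  product form contains \<open>qpoch (fps_X\<^sup>2) n\<close> once and the odd factors twice; one
  more \<open>qpoch (fps_X\<^sup>2) n\<close> completes a square.\<close>

lemma qpoch_square_eq_phi:
  "\<exists>\<phi> :: int fps. (\<forall>i. \<phi> $ i \<noteq> 0 \<longrightarrow> (\<exists>a::int. int i = a\<^sup>2)) \<and>
     dcong (fps_X ^ n) ((qpoch fps_X n)\<^sup>2) (\<phi> * qpoch (fps_X\<^sup>2) n)"
proof -
  define X :: "int fps" where "X = fps_X"
  let ?S = "\<Sum>k\<le>2*n. (-1) ^ (k + n) * X ^ theta_exp 2 (int k - int n)"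
  let ?P = "\<Prod>i<n. 1 - X ^ (2*i + 1)"
  have X: "X \<noteq> 0" "X $ 0 = 0" by (auto simp: X_def)
  have B: "dcong (X ^ n) (qpoch (X\<^sup>2) n * (?P * ?P)) ?S"
    using theta_dcong[OF X, of n 0] by (simp only: add_0 add_0_right)
  have C: "dcong (X ^ n) (qpoch X (2*n) * qpoch X (2*n)) (?S * qpoch (X\<^sup>2) n)"
    using dcong_mult[OF B dcong_refl[of _ "qpoch (X\<^sup>2) n"]]
    unfolding qpoch_square[symmetric] by (simp only: mult_ac)
  have "dcong (X ^ n) (qpoch X n) (qpoch X (2 * n))"
    by (rule dcong_qpoch_power) simp
  from dcong_trans[OF dcong_mult[OF this this] C]
  have "dcong (X ^ n) ((qpoch X n)\<^sup>2) (?S * qpoch (X\<^sup>2) n)"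
    by (simp only: power2_eq_square)
  moreover have "\<exists>a::int. int i = a\<^sup>2" if i: "?S $ i \<noteq> 0" for i
  proof -
    obtain k where "theta_exp 2 (int k - int n) = i"
      using fps_sum_nth_neq_0[OF i[unfolded X_def]] by blast
    with int_theta_exp[of 2 "int k - int n"] have "2 * int i = 2 * (int k - int n)\<^sup>2"
      by (simp add: power2_eq_square)
    then show ?thesis by auto
  qed
  ultimately show ?thesis unfolding X_def by blast
qed

text \<open>Gauss' identity from the triple product at \<open>z = 1\<close>: the indices
  \<open>j\<close> and \<open>1 - j\<close> have equal exponents, so the theta sum is twice the
  triangular series. The product side is even as well, through the factor
  \<open>1 + X ^ 0\<close>.\<close>

lemma psi_dcong:
  "dcong (fps_X ^ n) (qpoch fps_X n * (\<Sum>t<n. fps_X ^ (Suc t choose 2))) ((qpoch (fps_X\<^sup>2) n)\<^sup>2 :: int fps)"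
proof -
  define X :: "int fps" where "X = fps_X"
  have X: "X \<noteq> 0" "X $ 0 = 0" by (auto simp: X_def)
  let ?a = "\<Prod>i=1..n. 1 + X ^ i" and ?b = "\<Prod>i<n. 1 + X ^ i"
  let ?S = "\<Sum>t<n. X ^ (Suc t choose 2)"
  have T: "pronic_half (- int t) = (Suc t choose 2)" "pronic_half (int t + 1) = (Suc t choose 2)" for t
    using pronic_half[of "- int t"] pronic_half[of "int t + 1"] two_choose_two[of "Suc t"]
    by (auto simp: algebra_simps)
  have 1: "dcong (X ^ n) (qpoch X (2*n) * (?a * ?b)) (\<Sum>k\<le>2*n. X ^ pronic_half (int k - int n))"
    using jacobi_triple_product_dcong[of X n 1] X by (simp add: qpoch_dvd_1)
  have "{..2*n} = {..n} \<union> {n+1..2*n}" by auto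
  then have "(\<Sum>k\<le>2*n. X ^ pronic_half (int k - int n)) = 
     (\<Sum>k\<le>n. X ^ pronic_half (int k - int n)) + (\<Sum>k=n+1..2*n. X ^ pronic_half (int k - int n))"
    by (simp add: sum.union_disjoint ivl_disj_int)
  \<comment> \<open>The indices \<open>- t\<close> with \<open>t \<le> n\<close> and, below,
    \<open>t + 1\<close> with \<open>t < n\<close>; the unpaired term at \<open>t = n\<close>
    vanishes modulo \<open>X ^ n\<close>.\<close>
  also have "(\<Sum>k\<le>n. X ^ pronic_half (int k - int n)) = (\<Sum>t\<le>n. X ^ (Suc t choose 2))"
    by (rule sum.reindex_bij_witness[of _ "\<lambda>t. n - t" "\<lambda>t. n - t"]) (auto simp: T(1)[symmetric] of_nat_diff)
  also have "\<dots> = ?S + X ^ (Suc n choose 2)" by (simp flip: lessThan_Suc_atMost)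
  also have "(\<Sum>k=n+1..2*n. X ^ pronic_half (int k - int n)) = ?S"
    by (rule sum.reindex_bij_witness[of _ "\<lambda>t. n + 1 + t" "\<lambda>k. k - (n + 1)"])
       (auto simp: T(2)[symmetric] of_nat_diff)
  finally have 2: "(\<Sum>k\<le>2*n. X ^ pronic_half (int k - int n)) = 2 * ?S + X ^ (Suc n choose 2)"
    by simp
  have "X ^ n dvd X ^ (Suc n choose 2)" by (rule le_imp_power_dvd) (simp add: numeral_2_eq_2)
  then have "dcong (X ^ n) (2 * ?S + X ^ (Suc n choose 2)) (2 * ?S)" by (simp add: dcong_def)
  from dcong_trans[OF 1[unfolded 2] this]
  have 3: "dcong (X ^ n) (qpoch X (2*n) * (?a * ?b)) (2 * ?S)" .
  have "?b * (1 + X ^ n) = (\<Prod>i\<in>{..<Suc n}. 1 + X ^ i)" by simp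
  also have "\<dots> = 2 * ?a"
  proof -
    have "{..<Suc n} = insert 0 {1..n}" by auto
    then show ?thesis by simp
  qed
  finally have b: "?b * (1 + X ^ n) = 2 * ?a" .
  have "2 * ?a - ?b = X ^ n * ?b" unfolding b[symmetric] by (simp add: algebra_simps)
  then have 4: "dcong (X ^ n) (2 * ?a) ?b" by (simp add: dcong_def)
  have 5: "dcong (X ^ n) (qpoch X n) (qpoch X (2 * n))"
    by (rule dcong_qpoch_power) simp
  from dcong_trans[OF dcong_mult[OF 5 dcong_mult[OF dcong_refl[of _ ?a] 4]] 3]
  have "dcong (X ^ n) (qpoch X n * (?a * (2 * ?a))) (2 * ?S)" .
  from dcong_mult[OF dcong_refl[of _ "qpoch X n"] this]
  have "dcong (X ^ n) (2 * (qpoch (X^2) n)\<^sup>2) (2 * (qpoch X n * ?S))"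
    unfolding qpoch_mult_prod_plus[symmetric] by (simp add: power2_eq_square mult_ac)
  then have "dcong (X ^ n) ((qpoch (X^2) n)\<^sup>2) (qpoch X n * ?S)"
    unfolding X_def dcong_fps_X_power by (simp add: numeral_fps_const)
  then show ?thesis unfolding X_def by (rule dcong_sym)
qed

text \<open>Factor by factor: \<open>(1 - y)\<^sup>2\<close> and \<open>1 - y\<^sup>2\<close> agree
  modulo 2, hence their squares agree modulo 4.\<close>

lemma qpoch_power_4: "dcong 4 (qpoch q n ^ 4) ((qpoch (q\<^sup>2) n)\<^sup>2)"
proof (induction n)
  case (Suc n)
  have "(1 - y) ^ 4 - (1 - y\<^sup>2)\<^sup>2 = 4 * (- y + 2 * y\<^sup>2 - y ^ 3)" for y :: 'a
    by (simp add: power2_eq_square power3_eq_cube power4_eq_xxxx algebra_simps)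
  then have "dcong 4 ((1 - y) ^ 4) ((1 - y\<^sup>2)\<^sup>2)" for y :: 'a
    unfolding dcong_def by (metis dvd_triv_left)
  from dcong_mult[OF Suc this[of "q ^ Suc n"]] show ?case
    by (simp add: qpoch_Suc power_mult_distrib power_commutes flip: power_mult)
       (simp add: mult.commute)
qed simp

subsection \<open>Partitions and mex\<close>

definition partition_fps :: "nat \<Rightarrow> int fps" where
  "partition_fps m = Abs_fps (\<lambda>n. int (card {\<pi> \<in> partitions n. \<forall>x\<in>#\<pi>. x \<le> m}))"

lemma partition_parts_le: "\<pi> \<in> partitions n \<Longrightarrow> x \<in># \<pi> \<Longrightarrow> x \<le> n"
  unfolding partitions_def by (auto dest: multi_member_split)

lemma partition_fps_0: "partition_fps 0 = 1"
proof (rule fps_ext)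
  fix n
  have "{\<pi> \<in> partitions n. \<forall>x\<in>#\<pi>. x \<le> 0} = (if n = 0 then {{#}} else {})"
  proof -
    have "\<pi> \<in> partitions n \<and> (\<forall>x\<in>#\<pi>. x \<le> 0) \<longleftrightarrow> n = 0 \<and> \<pi> = {#}" for \<pi>
      by (cases "\<pi> = {#}") (auto simp: partitions_def elim!: multiset_nonemptyE)
    then show ?thesis by auto
  qed
  then show "partition_fps 0 $ n = 1 $ n" unfolding partition_fps_def by simp
qed

text \<open>A partition with parts at most \<open>Suc m\<close> either avoids the part
  \<open>Suc m\<close> or arises from a smaller one by adding one copy of it.\<close>

lemma partition_fps_Suc: "partition_fps (Suc m) * (1 - fps_X ^ Suc m) = partition_fps m"
proof (rule fps_ext)
  fix n
  let ?P = "\<lambda>m n. {\<pi> \<in> partitions n. \<forall>x\<in>#\<pi>. x \<le> m}"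
  define Q where "Q = {\<pi> \<in> ?P (Suc m) n. Suc m \<in># \<pi>}"
  have fin: "finite (?P m n)" for m n using finite_partitions by simp
  have "?P (Suc m) n = ?P m n \<union> Q" by (auto simp: Q_def le_Suc_eq)
  moreover have "?P m n \<inter> Q = {}" by (force simp: Q_def)
  moreover have "finite Q" using finite_partitions by (simp add: Q_def)
  ultimately have "card (?P (Suc m) n) = card (?P m n) + card Q"
    using fin by (simp add: card_Un_disjoint)
  moreover have "card Q = (if n < Suc m then 0 else card (?P (Suc m) (n - Suc m)))"
  proof (cases "n < Suc m")
    case True
    then have "Q = {}" using partition_parts_le by (fastforce simp: Q_def)
    then show ?thesis using True by (metis card.empty)
  next
    case False
    have "bij_betw (add_mset (Suc m)) (?P (Suc m) (n - Suc m)) Q"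
    proof (rule bij_betwI')
      fix \<pi> assume "\<pi> \<in> Q"
      moreover then obtain \<rho> where "\<pi> = add_mset (Suc m) \<rho>" by (auto simp: Q_def dest: multi_member_split)
      ultimately show "\<exists>\<rho>\<in>?P (Suc m) (n - Suc m). \<pi> = add_mset (Suc m) \<rho>"
        by (intro bexI[of _ \<rho>]) (auto simp: Q_def partitions_def)
    qed (use False in \<open>auto simp: Q_def partitions_def\<close>)
    from bij_betw_same_card[OF this] show ?thesis using False by simp
  qed
  ultimately have "partition_fps (Suc m) $ n = partition_fps m $ n +
      (if n < Suc m then 0 else partition_fps (Suc m) $ (n - Suc m))"
    unfolding partition_fps_def by simp
  then show "(partition_fps (Suc m) * (1 - fps_X ^ Suc m)) $ n = partition_fps m $ n"
    by (simp only: right_diff_distrib fps_sub_nth fps_X_power_mult_right_nth) simp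
qed

lemma partition_fps_mult_qpoch: "partition_fps m * qpoch fps_X m = 1"
proof (induction m)
  case (Suc m)
  then show ?case by (metis mult.assoc mult.commute partition_fps_Suc qpoch_Suc)
qed (simp add: partition_fps_0)

lemma less_mex_iff: "k < mex \<pi> \<longleftrightarrow> {1..k} \<subseteq> set_mset \<pi>"
proof
  assume *: "k < mex \<pi>"
  show "{1..k} \<subseteq> set_mset \<pi>"
  proof
    fix i assume "i \<in> {1..k}"
    then have "i < (LEAST m. 0 < m \<and> m \<notin># \<pi>)" "0 < i" using * by (auto simp: mex_def)
    then show "i \<in># \<pi>" using not_less_Least by blast
  qed
next
  assume *: "{1..k} \<subseteq> set_mset \<pi>"
  \<comment> \<open>Finiteness of the multiset provides a missing positive integer, so that
    \<open>LEAST\<close> in \<open>mex\<close> is attained.\<close>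
  obtain m where "\<forall>x\<in>#\<pi>. x < m"
    using finite_nat_set_iff_bounded[of "set_mset \<pi>"] by auto
  then have "\<exists>m. 0 < m \<and> m \<notin># \<pi>" by (intro exI[of _ "Suc m"]) auto
  then have "0 < mex \<pi> \<and> mex \<pi> \<notin># \<pi>" unfolding mex_def by (rule LeastI_ex)
  then show "k < mex \<pi>" using * by (auto simp: subset_iff) (metis not_less less_eq_Suc_le One_nat_def)
qed

text \<open>A mex above \<open>k\<close> means that one copy each of 1 to \<open>k\<close> is
  contained in the partition. Removing these copies, with sum \<open>Suc k choose 2\<close>, leaves
  an arbitrary partition.\<close>

lemma card_partitions_mex:
  "card {\<pi> \<in> partitions n. k < mex \<pi>}
    = (if n < (Suc k choose 2) then 0 else card (partitions (n - (Suc k choose 2))))"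
proof -
  define M where "M = mset_set {1..k}"
  have M: "sum_mset M = (Suc k choose 2)" unfolding M_def
    by (induction k) (auto simp: numeral_2_eq_2 atLeastAtMostSuc_conv)
  have pos: "\<forall>x\<in>#M. 0 < x" by (auto simp: M_def)
  have less: "k < mex \<pi> \<longleftrightarrow> M \<subseteq># \<pi>" for \<pi>
    unfolding less_mex_iff M_def
    by (auto simp: subseteq_mset_def count_mset_set' subset_iff Suc_le_eq)
  show ?thesis
  proof (cases "n < (Suc k choose 2)")
    case True
    have "{\<pi> \<in> partitions n. k < mex \<pi>} = {}"
      unfolding less using True M
      by (auto simp: partitions_def dest!: subset_mset.le_iff_add[THEN iffD1])
    then show ?thesis using True by (metis card.empty)
  next
    case False
    have "bij_betw (\<lambda>\<rho>. M + \<rho>) (partitions (n - (Suc k choose 2))) {\<pi> \<in> partitions n. k < mex \<pi>}"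
    proof (rule bij_betwI')
      fix \<pi> assume \<pi>: "\<pi> \<in> {\<pi> \<in> partitions n. k < mex \<pi>}"
      then obtain \<rho> where "\<pi> = M + \<rho>" unfolding less by (auto simp: subset_mset.le_iff_add)
      then show "\<exists>\<rho>\<in>partitions (n - (Suc k choose 2)). \<pi> = M + \<rho>"
        using \<pi> M by (intro bexI[of _ \<rho>]) (auto simp: partitions_def)
    qed (use False M pos in \<open>auto simp: partitions_def less\<close>)
    from bij_betw_same_card[OF this] show ?thesis using False by simp
  qed
qed

text \<open>Each mex is the number of \<open>k\<close> below it. The cutoff \<open>L\<close>
  suffices because a mex above \<open>L\<close> would make \<open>L\<close> a part of a partition of
  \<open>n < L\<close>.\<close>

lemma sigma_mex_eq_sum:
  assumes "n < L"
  shows "sigma_mex n = (\<Sum>k<L. card {\<pi> \<in> partitions n. k < mex \<pi>})"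
proof -
  have mex: "mex \<pi> = (\<Sum>k<L. of_bool (k < mex \<pi>))" if "\<pi> \<in> partitions n" for \<pi>
  proof -
    have "\<not> L < mex \<pi>"
    proof
      assume "L < mex \<pi>"
      then have "L \<in># \<pi>" using assms unfolding less_mex_iff by auto
      then show False using partition_parts_le[OF that] assms by fastforce
    qed
    then have "{..<L} \<inter> {k. k < mex \<pi>} = {..<mex \<pi>}" by auto
    then show ?thesis by (simp add: sum_of_bool_eq)
  qed
  have "sigma_mex n = (\<Sum>\<pi>\<in>partitions n. \<Sum>k<L. of_bool (k < mex \<pi>))"
    unfolding sigma_mex_def by (rule sum.cong[OF refl mex])
  also have "\<dots> = (\<Sum>k<L. \<Sum>\<pi>\<in>partitions n. of_bool (k < mex \<pi>))" by (rule sum.swap)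
  also have "\<dots> = (\<Sum>k<L. card {\<pi> \<in> partitions n. k < mex \<pi>})"
    using finite_partitions by (simp add: sum_of_bool_eq Collect_conj_eq)
  finally show ?thesis .
qed

definition sigma_mex_fps :: "int fps" where
  "sigma_mex_fps = Abs_fps (\<lambda>n. int (sigma_mex n))"

lemma sigma_mex_fps_dcong:
  "dcong (fps_X ^ L) (sigma_mex_fps * qpoch fps_X L) (\<Sum>t<L. fps_X ^ (Suc t choose 2))"
proof -
  let ?S = "\<Sum>t<L. fps_X ^ (Suc t choose 2) :: int fps"
  have "dcong (fps_X ^ L) sigma_mex_fps (?S * partition_fps L)"
    unfolding dcong_fps_X_power
  proof (intro allI impI)
    fix n assume n: "n < L"
    have p: "partition_fps L $ m = int (card (partitions m))" if "m \<le> n" for m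
    proof -
      have "{\<pi> \<in> partitions m. \<forall>x\<in>#\<pi>. x \<le> L} = partitions m"
        using that n partition_parts_le by fastforce
      then show ?thesis by (simp add: partition_fps_def)
    qed
    have "sigma_mex_fps $ n = (\<Sum>k<L. int (card {\<pi> \<in> partitions n. k < mex \<pi>}))"
      unfolding sigma_mex_fps_def by (simp add: sigma_mex_eq_sum[OF n])
    also have "\<dots> = (\<Sum>k<L. (fps_X ^ (Suc k choose 2) * partition_fps L) $ n)"
      unfolding card_partitions_mex fps_X_power_mult_nth
      by (intro sum.cong) (auto simp: p)
    finally show "sigma_mex_fps $ n = (?S * partition_fps L) $ n"
      by (simp add: sum_distrib_right fps_sum_nth)
  qed
  from dcong_mult[OF this dcong_refl[of _ "qpoch fps_X L"]]
  show ?thesis by (simp add: mult.assoc partition_fps_mult_qpoch)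
qed

lemma sigma_mex_cong_qpoch_square:
  assumes "N < L"
  shows "[int (sigma_mex N) = ((qpoch fps_X L)\<^sup>2) $ N] (mod 4)"
proof -
  let ?P = "qpoch fps_X L :: int fps"
  from dcong_trans[OF dcong_mult[OF sigma_mex_fps_dcong dcong_refl[of _ ?P], of L]] psi_dcong[of L]
  have "dcong (fps_X ^ L) (sigma_mex_fps * ?P\<^sup>2) ((qpoch (fps_X\<^sup>2) L)\<^sup>2)"
    by (simp add: mult_ac power2_eq_square)
  \<comment> \<open>The two congruences have different moduli, \<open>fps_X ^ L\<close> and 4.
    Explicit remainders \<open>r\<close> and \<open>s\<close> let them be combined and read off at
    degree \<open>N < L\<close>.\<close>
  then obtain r where r: "sigma_mex_fps * ?P\<^sup>2 - (qpoch (fps_X\<^sup>2) L)\<^sup>2 = fps_X ^ L * r"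
    unfolding dcong_def by (elim dvdE)
  obtain s where s: "?P ^ 4 - (qpoch (fps_X\<^sup>2) L)\<^sup>2 = 4 * s"
    using qpoch_power_4[of "fps_X :: int fps" L] unfolding dcong_def by (elim dvdE)
  let ?u = "(partition_fps L)\<^sup>2"
  have u: "?P\<^sup>2 * ?u = 1"
    using partition_fps_mult_qpoch[of L] by (metis mult.commute power_mult_distrib power_one)
  have "sigma_mex_fps - ?P\<^sup>2 = (sigma_mex_fps - ?P\<^sup>2) * (?P\<^sup>2 * ?u)" unfolding u by simp
  also have "\<dots> = (sigma_mex_fps * ?P\<^sup>2 - ?P ^ 4) * ?u"
    by (simp add: algebra_simps power2_eq_square power4_eq_xxxx)
  also have "sigma_mex_fps * ?P\<^sup>2 - ?P ^ 4 = fps_X ^ L * r - 4 * s"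
    using r s by (simp add: algebra_simps)
  finally have "sigma_mex_fps - ?P\<^sup>2 = fps_X ^ L * (r * ?u) - fps_const 4 * (s * ?u)"
    by (simp add: algebra_simps numeral_fps_const)
  then have "(sigma_mex_fps - ?P\<^sup>2) $ N = (fps_X ^ L * (r * ?u) - fps_const 4 * (s * ?u)) $ N"
    by (rule arg_cong)
  also have "\<dots> = - (4 * (s * ?u) $ N)"
    using assms by (simp only: fps_sub_nth fps_X_power_mult_nth fps_mult_left_const_nth) simp
  finally show ?thesis by (simp add: sigma_mex_fps_def cong_iff_dvd_diff)
qed

subsection \<open>Primes dividing binary quadratic forms\<close>

lemma fermat_int:
  assumes "prime (p::nat)" "\<not> int p dvd a"
  shows "[a ^ (p - 1) = 1] (mod int p)"
proof -
  define b where "b = nat (a mod int p)"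
  have p: "p > 0" using assms prime_gt_0_nat by blast
  have b: "int b = a mod int p" using p by (simp add: b_def)
  have "\<not> p dvd b"
    using assms(2) b by (metis dvd_mod_imp_dvd dvd_refl int_dvd_int_iff)
  then have "[b ^ (p - 1) = 1] (mod p)" by (rule fermat_theorem[OF assms(1)])
  then have "[int b ^ (p - 1) = 1] (mod int p)" by (metis cong_int_iff of_nat_1 of_nat_power)
  then show ?thesis unfolding b by (simp add: cong_def power_mod)
qed

text \<open>Otherwise -1 would be a square modulo \<open>p\<close>: raising
  \<open>u\<^sup>2 = - v\<^sup>2\<close> to the odd power \<open>(p - 1) / 2\<close> contradicts
  Fermat's theorem.\<close>

lemma prime_dvd_sum_squares:
  assumes p: "prime p" "[p = 3] (mod 4)" and d: "int p dvd u\<^sup>2 + v\<^sup>2"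
  shows "int p dvd v"
proof (rule ccontr)
  assume v: "\<not> int p dvd v"
  have P: "prime (int p)" using p by simp
  have u: "\<not> int p dvd u"
    using v d P by (metis dvd_add_right_iff power2_eq_square dvd_mult prime_dvd_mult_iff)
  define m where "m = p div 4"
  have m: "p - 1 = 2 * (2 * m + 1)" using p(2) unfolding m_def cong_def by presburger
  have "[u\<^sup>2 = - (v\<^sup>2)] (mod int p)" using d by (simp add: cong_iff_dvd_diff)
  then have "[(u\<^sup>2) ^ (2*m+1) = (- (v\<^sup>2)) ^ (2*m+1)] (mod int p)" by (rule cong_pow)
  then have "[u ^ (p - 1) = - (v ^ (p - 1))] (mod int p)"
    unfolding m power_mult by simp
  moreover have "[u ^ (p - 1) = 1] (mod int p)" "[v ^ (p - 1) = 1] (mod int p)"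
    using fermat_int p(1) u v by auto
  ultimately have "[1 = - 1] (mod int p)"
    by (metis cong_minus_minus_iff cong_sym cong_trans)
  then have "int p dvd 2" by (simp add: cong_iff_dvd_diff)
  then have "p dvd 2" by presburger
  then have "p = 2 \<or> p = 1" by (metis p(1) primes_dvd_imp_eq two_is_prime_nat)
  then show False using p(2) by (auto simp: cong_def)
qed

lemma prime_dvd_square_plus_3_square:
  assumes p: "prime p" "[p = 2] (mod 3)" "p \<noteq> 2" and d: "int p dvd u\<^sup>2 + 3 * v\<^sup>2"
  shows "int p dvd v"
proof (rule ccontr)
  assume v: "\<not> int p dvd v"
  have P: "prime (int p)" using p by simp
  have small: "\<not> int p dvd 2" "\<not> int p dvd 3"
  proof -
    have "p = q" if "int p dvd int q" "prime q" for q
      using that p(1) by (metis int_dvd_int_iff primes_dvd_imp_eq)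
    from this[of 2] this[of 3] show "\<not> int p dvd 2" "\<not> int p dvd 3"
      using p by (auto simp: cong_def)
  qed
  \<comment> \<open>\<open>A / B\<close> is a primitive cube root of unity modulo \<open>p\<close>, but \<open>3\<close> does not divide \<open>p - 1\<close>.\<close>
  define A where "A = u - v"
  define B where "B = 2 * v"
  have AB: "A\<^sup>2 + A * B + B\<^sup>2 = u\<^sup>2 + 3 * v\<^sup>2"
    by (simp add: A_def B_def power2_eq_square algebra_simps)
  have B: "\<not> int p dvd B" using v small P unfolding B_def by (simp add: prime_dvd_mult_iff)
  have A: "\<not> int p dvd A"
  proof
    assume A: "int p dvd A"
    then have "int p dvd A\<^sup>2 + A * B" by (simp add: power2_eq_square)
    then have "int p dvd B\<^sup>2" using d AB by (metis dvd_add_right_iff)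
    then show False using B P by (metis prime_dvd_power)
  qed
  have "A ^ 3 - B ^ 3 = (A - B) * (u\<^sup>2 + 3 * v\<^sup>2)"
    unfolding AB[symmetric] by (simp add: power2_eq_square power3_eq_cube algebra_simps)
  then have c: "[A ^ 3 = B ^ 3] (mod int p)" using d by (simp add: cong_iff_dvd_diff)
  define m where "m = p div 3"
  \<comment> \<open>Equal cubes give equal powers with exponent \<open>3 * m\<close>; by Fermat the
    powers with exponent \<open>3 * m + 1\<close> are both 1, which forces \<open>A = B\<close>
    modulo \<open>p\<close>.\<close>
  have m: "p - 1 = 3 * m + 1" using p(2) unfolding m_def cong_def by presburger
  have "[(A ^ 3) ^ m = (B ^ 3) ^ m] (mod int p)" using c by (rule cong_pow)
  then have c: "[A ^ (3 * m) = B ^ (3 * m)] (mod int p)" by (simp add: power_mult)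
  have "[A * A ^ (3 * m) = 1] (mod int p)" "[B * B ^ (3 * m) = 1] (mod int p)"
    using fermat_int[OF p(1) A] fermat_int[OF p(1) B] unfolding m by simp_all
  moreover have "[B * A ^ (3 * m) = B * B ^ (3 * m)] (mod int p)" using c by (rule cong_scalar_left)
  ultimately have "[A * A ^ (3 * m) = B * A ^ (3 * m)] (mod int p)"
    by (meson cong_sym cong_trans)
  moreover have "coprime (A ^ (3 * m)) (int p)"
    using A P by (meson coprime_commute coprime_power_left_iff prime_imp_coprime)
  ultimately have "[A = B] (mod int p)" by (simp add: cong_mult_rcancel)
  then have "int p dvd A - B" by (simp add: cong_iff_dvd_diff)
  \<comment> \<open>The multiple of \<open>A - B\<close> that reduces
    \<open>A\<^sup>2 + A * B + B\<^sup>2\<close> to \<open>3 * B\<^sup>2\<close>.\<close>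
  then have "int p dvd (A - B) * (A + 2 * B)" by simp
  then have "int p dvd (u\<^sup>2 + 3 * v\<^sup>2) - (A - B) * (A + 2 * B)" using d by (intro dvd_diff)
  also have "\<dots> = 3 * B\<^sup>2" unfolding AB[symmetric] by (simp add: power2_eq_square algebra_simps)
  finally show False using small(2) B P by (metis prime_dvd_mult_iff prime_dvd_power)
qed

text \<open>Infinite descent on \<open>\<bar>Q\<bar>\<close>: \<open>p\<close> divides
  \<open>v\<close>, hence \<open>u\<close>, so \<open>p\<^sup>2\<close> divides the form and
  \<open>p\<close> divides \<open>Q\<close>. Dividing all three by \<open>p\<close> gives a smaller
  solution.\<close>

lemma square_form_no_odd_multiplicity:
  fixes p :: int
  assumes p: "prime p" and form: "\<And>u v. p dvd u\<^sup>2 + d * v\<^sup>2 \<Longrightarrow> p dvd v"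
    and t: "\<not> p dvd t" and "Q \<noteq> 0"
  shows "u\<^sup>2 + d * v\<^sup>2 \<noteq> Q\<^sup>2 * p * t"
  using assms(4)
proof (induction "nat \<bar>Q\<bar>" arbitrary: Q u v rule: less_induct)
  case less
  have p1: "\<bar>p\<bar> > 1" using prime_gt_1_int[OF p] by simp
  show ?case
  proof
    assume eq: "u\<^sup>2 + d * v\<^sup>2 = Q\<^sup>2 * p * t"
    then have v: "p dvd v" using form[of u v] by simp
    then have "p dvd d * v\<^sup>2" by (simp add: power2_eq_square)
    then have "p dvd u\<^sup>2" using eq by (metis dvd_add_left_iff dvd_mult2 dvd_triv_right)
    then have "p dvd u" using p by (rule prime_dvd_power[rotated])
    with v obtain u' v' where uv: "u = p * u'" "v = p * v'" by (auto elim!: dvdE)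
    have "p * (p * (u'\<^sup>2 + d * v'\<^sup>2)) = p * (Q\<^sup>2 * t)"
      using eq unfolding uv by (simp add: power2_eq_square algebra_simps)
    then have e: "p * (u'\<^sup>2 + d * v'\<^sup>2) = Q\<^sup>2 * t" using p by simp
    then have "p dvd Q\<^sup>2 * t" by (metis dvd_triv_left)
    then have "p dvd Q" using t p by (meson prime_dvd_mult_iff prime_dvd_power)
    then obtain Q' where Q: "Q = p * Q'" by (elim dvdE)
    have "p * (u'\<^sup>2 + d * v'\<^sup>2) = p * (Q'\<^sup>2 * p * t)"
      using e unfolding Q by (simp add: power2_eq_square algebra_simps)
    then have "u'\<^sup>2 + d * v'\<^sup>2 = Q'\<^sup>2 * p * t" using p by simp
    moreover have "Q' \<noteq> 0" using less.prems Q by simp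
    moreover have "nat \<bar>Q'\<bar> < nat \<bar>Q\<bar>"
      unfolding Q abs_mult using p1 \<open>Q' \<noteq> 0\<close> by (simp add: nat_mono_iff)
    ultimately show False using less.hyps by blast
  qed
qed

subsection \<open>The congruence\<close>

lemma fps_mult_nth_neq_0:
  fixes f g :: "'a::comm_ring_1 fps"
  assumes "(f * g) $ n \<noteq> 0"
  obtains i where "i \<le> n" "f $ i \<noteq> 0" "g $ (n - i) \<noteq> 0"
proof -
  obtain i where "i \<in> {0..n}" "f $ i * g $ (n - i) \<noteq> 0"
    using assms sum.not_neutral_contains_not_neutral unfolding fps_mult_nth by blast
  moreover from this have "f $ i \<noteq> 0" "g $ (n - i) \<noteq> 0" by auto
  ultimately show ?thesis using that[of i] by simp
qed

text \<open>The residue 7 is covered by the form \<open>u\<^sup>2 + v\<^sup>2\<close>, 5 by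
  \<open>u\<^sup>2 + 3 * v\<^sup>2\<close>, and 11 by either. Truncation at \<open>Suc N\<close>
  keeps the coefficient at \<open>N\<close> exact.\<close>

lemma sigma_mex_cong_0:
  fixes Q t :: int
  assumes p: "prime p" "[p = 5] (mod 12) \<or> [p = 7] (mod 12) \<or> [p = 11] (mod 12)"
    and eq: "12 * int N + 1 = Q\<^sup>2 * int p * t" and t: "\<not> int p dvd t"
  shows "[sigma_mex N = 0] (mod 4)"
proof -
  let ?P = "qpoch fps_X (Suc N) :: int fps"
  have Q: "Q \<noteq> 0"
  proof
    assume "Q = 0"
    with eq have "12 * int N + 1 = 0" by simp
    then show False by presburger
  qed
  have P: "prime (int p)" using p(1) by simp
  have p2: "p \<noteq> 2" using p(2) by (auto simp: cong_def)
  have "p mod 12 = 5 \<or> p mod 12 = 7 \<or> p mod 12 = 11" using p(2) by (auto simp: cong_def)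
  then have "p mod 4 = 3 \<or> p mod 3 = 2" by presburger
  then consider "[p = 3] (mod 4)" | "[p = 2] (mod 3)" by (auto simp: cong_def)
  then have "?P\<^sup>2 $ N = 0"
  proof cases
    case 1
    show ?thesis
    proof (rule ccontr)
      assume "?P\<^sup>2 $ N \<noteq> 0"
      then obtain i where i: "i \<le> N" "?P $ i \<noteq> 0" "?P $ (N - i) \<noteq> 0"
        unfolding power2_eq_square by (rule fps_mult_nth_neq_0)
      obtain j :: int where j: "2 * int i = j * (3 * j - 1)"
        using qpoch_nth_neq_0[of 1 "Suc N" i] i by auto
      obtain l :: int where l: "2 * int (N - i) = l * (3 * l - 1)"
        using qpoch_nth_neq_0[of 1 "Suc N" "N - i"] i(3) by (auto simp: less_Suc_eq_le)
      \<comment> \<open>Completing the square turns a pentagonal number \<open>i\<close> into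
        \<open>24 * i + 1 = (6 * j - 1)\<^sup>2\<close>.\<close>
      have "(6 * j - 1)\<^sup>2 + 1 * (6 * l - 1)\<^sup>2 = 12 * (j * (3 * j - 1) + l * (3 * l - 1)) + 2"
        by (simp add: power2_eq_square algebra_simps)
      also have "\<dots> = 2 * (12 * int N + 1)"
        unfolding j[symmetric] l[symmetric] using i(1) by (simp add: of_nat_diff)
      also have "\<dots> = Q\<^sup>2 * int p * (2 * t)" unfolding eq by simp
      finally have "(6 * j - 1)\<^sup>2 + 1 * (6 * l - 1)\<^sup>2 = Q\<^sup>2 * int p * (2 * t)" .
      moreover have "\<not> int p dvd 2 * t"
      proof -
        have "\<not> p dvd 2" using p(1) p2 primes_dvd_imp_eq two_is_prime_nat by blast
        then have "\<not> int p dvd 2" by (metis int_dvd_int_iff of_nat_numeral)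
        then show ?thesis using t P by (simp add: prime_dvd_mult_iff)
      qed
      moreover have "int p dvd y" if "int p dvd x\<^sup>2 + 1 * y\<^sup>2" for x y
        using prime_dvd_sum_squares[OF p(1) 1, of x y] that by simp
      ultimately show False
        using square_form_no_odd_multiplicity[OF P _ _ Q, of 1 "2 * t"] by blast
    qed
  next
    case 2
    show ?thesis
    proof (rule ccontr)
      assume "?P\<^sup>2 $ N \<noteq> 0"
      moreover obtain \<phi> :: "int fps" where \<phi>: "\<And>i. \<phi> $ i \<noteq> 0 \<Longrightarrow> \<exists>a::int. int i = a\<^sup>2"
        "dcong (fps_X ^ Suc N) (?P\<^sup>2) (\<phi> * qpoch (fps_X\<^sup>2) (Suc N))"
        using qpoch_square_eq_phi[of "Suc N"] by blast
      ultimately have "(\<phi> * qpoch (fps_X\<^sup>2) (Suc N)) $ N \<noteq> 0"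
        unfolding dcong_fps_X_power by simp
      then obtain i where i: "i \<le> N" "\<phi> $ i \<noteq> 0" "qpoch (fps_X\<^sup>2 :: int fps) (Suc N) $ (N - i) \<noteq> 0"
        by (rule fps_mult_nth_neq_0)
      obtain a :: int where a: "int i = a\<^sup>2" using \<phi>(1) i(2) by blast
      obtain l :: int where l: "2 * int (N - i) = 2 * (l * (3 * l - 1))"
        using qpoch_nth_neq_0[of 2 "Suc N" "N - i"] i(3) by (auto simp: less_Suc_eq_le)
      \<comment> \<open>Here \<open>N - i\<close> is twice a pentagonal number, so
        \<open>12 * (N - i) + 1\<close> is a square, and \<open>12 * i\<close> is
        \<open>3 * (2 * a)\<^sup>2\<close>.\<close>
      have "(6 * l - 1)\<^sup>2 + 3 * (2 * a)\<^sup>2 = 6 * (2 * (l * (3 * l - 1))) + 12 * a\<^sup>2 + 1"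
        by (simp add: power2_eq_square algebra_simps)
      also have "\<dots> = 12 * int N + 1"
        unfolding a[symmetric] l[symmetric] using i(1) by (simp add: of_nat_diff)
      finally have "(6 * l - 1)\<^sup>2 + 3 * (2 * a)\<^sup>2 = Q\<^sup>2 * int p * t" unfolding eq .
      then show False
        using square_form_no_odd_multiplicity[OF P _ t Q, of 3]
          prime_dvd_square_plus_3_square[OF p(1) 2 p2] by blast
    qed
  qed
  then have "[int (sigma_mex N) = int 0] (mod int 4)"
    using sigma_mex_cong_qpoch_square[of N "Suc N"] by simp
  then show ?thesis by (simp only: cong_int_iff)
qed

text \<open>\<open>j\<close> may be negative, so the argument is an integer expression; it is tied
  to a natural number \<open>N\<close> through \<open>int N\<close>.\<close>

theorem theorem1p1:
  fixes k n N :: nat and p :: "nat \<Rightarrow> nat" and j :: int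
  assumes "\<And>i. 1 \<le> i \<Longrightarrow> i \<le> k + 1 \<Longrightarrow> prime (p i)"
    and "\<And>i. 1 \<le> i \<Longrightarrow> i \<le> k + 1 \<Longrightarrow> p i \<ge> 5"
    and "\<And>i. 1 \<le> i \<Longrightarrow> i \<le> k + 1 \<Longrightarrow>
           [p i = 5] (mod 12) \<or> [p i = 7] (mod 12) \<or> [p i = 11] (mod 12)"
    and "\<not> [j = 0] (mod int (p (k + 1)))"
    and "int N = (\<Prod>i=1..k+1. int (p i) ^ 2) * int n
           + (\<Prod>i=1..k. int (p i) ^ 2) * int (p (k + 1)) * j
           + ((\<Prod>i=1..k. int (p i) ^ 2) * int (p (k + 1)) ^ 2 - 1) div 12"
  shows "[sigma_mex N = 0] (mod 4)"
proof -
  define r where "r = p (k + 1)"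
  define Q where "Q = (\<Prod>i=1..k. int (p i))"
  have r: "prime r" "r \<ge> 5" "[r = 5] (mod 12) \<or> [r = 7] (mod 12) \<or> [r = 11] (mod 12)"
    unfolding r_def using assms(1-3) by simp_all
  \<comment> \<open>This makes the division by 12 in the argument exact.\<close>
  have sq: "[int (p i) ^ 2 = 1] (mod 12)" if "i \<in> {1..k+1}" for i
  proof -
    have "[p i = 5] (mod 12) \<or> [p i = 7] (mod 12) \<or> [p i = 11] (mod 12)"
      using that assms(3) by simp
    then have "[p i ^ 2 = 1] (mod 12)"
      by (auto simp: cong_def power2_eq_square mod_mult_eq[of "p i" 12 "p i", symmetric])
    then have "[int (p i ^ 2) = int 1] (mod int 12)" by (simp only: cong_int_iff)
    then show ?thesis by simp
  qed
  have "[(\<Prod>i=1..k+1. int (p i) ^ 2) = (\<Prod>i=1..k+1. 1)] (mod 12)"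
    by (rule cong_prod) (rule sq)
  then have "[Q\<^sup>2 * int r ^ 2 = 1] (mod 12)"
    by (simp add: Q_def r_def prod_power_distrib)
  then have "12 dvd Q\<^sup>2 * int r ^ 2 - 1" by (simp add: cong_iff_dvd_diff)
  then have d: "12 * ((Q\<^sup>2 * int r ^ 2 - 1) div 12) = Q\<^sup>2 * int r ^ 2 - 1" by simp
  have "int N = Q\<^sup>2 * int r ^ 2 * int n + Q\<^sup>2 * int r * j + (Q\<^sup>2 * int r ^ 2 - 1) div 12"
    using assms(5) by (simp add: Q_def r_def prod_power_distrib)
  then have "12 * int N + 1 = 12 * (Q\<^sup>2 * int r ^ 2 * int n) + 12 * (Q\<^sup>2 * int r * j) + Q\<^sup>2 * int r ^ 2"
    using d by linarith
  also have "\<dots> = Q\<^sup>2 * int r * (int r * (12 * int n + 1) + 12 * j)"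
    by (simp add: power2_eq_square algebra_simps)
  finally have "12 * int N + 1 = Q\<^sup>2 * int r * (int r * (12 * int n + 1) + 12 * j)" .
  moreover have "\<not> int r dvd int r * (12 * int n + 1) + 12 * j"
  proof
    assume "int r dvd int r * (12 * int n + 1) + 12 * j"
    then have "int r dvd 12 * j" by (metis dvd_add_right_iff dvd_triv_left)
    moreover have "coprime (int r) 12"
    proof -
      have "coprime r m" if "prime m" "m < 5" for m
        using that r(1,2) by (intro primes_coprime) auto
      from this[of 2] this[of 3] have "coprime r (2 * 2 * 3)" by (simp only: coprime_mult_right_iff) simp
      then have "coprime (int r) (int 12)" by (simp only: coprime_int_iff) simp
      then show ?thesis by simp
    qed
    ultimately have "int r dvd j" by (simp add: coprime_dvd_mult_right_iff)
    then show False using assms(4) by (simp add: r_def cong_0_iff)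
  qed
  ultimately show ?thesis using sigma_mex_cong_0 r(1,3) by blast
qed

end
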